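(* Let $G$ be a graph in $\varepsilon_0$ with $p$ vertices and $q$ edges. Then $G$ is bipartite and $q\equiv 0 \pmod 4$.
   Context: All graphs are finite, simple, undirected and connected. An Euler graph is a connected graph in which every vertex has even degree. $\varepsilon_0$ denotes the class of Euler graphs $G$ such that every cycle of $G$ has length $n\equiv 0 \pmod 4$. *)

theory Defs
  imports "Graph_Theory.Digraph_Component" "HOL-Number_Theory.Cong"
begin

text \<open>
  Finite simple undirected graphs are the symmetric digraphs of the locale \<^locale>\<open>graph\<close>:
  an undirected edge is a pair of opposite arcs. Edges and degrees are therefore counted on
  the sets of endpoints, not on the arcs.
\<close>

definition undirected_edges :: "('a, 'b) pre_digraph \<Rightarrow> 'a set set" where
  "undirected_edges G = {{tail G a, head G a} |a. a \<in> arcs G}"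

definition degree :: "('a, 'b) pre_digraph \<Rightarrow> 'a \<Rightarrow> nat" where
  "degree G v = card {e \<in> undirected_edges G. v \<in> e}"

text \<open>
  The closed walk \<open>u, v, u\<close> along an arc and its reverse satisfies \<^const>\<open>pre_digraph.cycle\<close>.
  In a simple graph the bound on the length excludes exactly these walks.
\<close>

definition undirected_cycle :: "('a, 'b) pre_digraph \<Rightarrow> 'b awalk \<Rightarrow> bool" where
  "undirected_cycle G c \<longleftrightarrow> pre_digraph.cycle G c \<and> 3 \<le> length c"

definition bipartite :: "('a, 'b) pre_digraph \<Rightarrow> bool" where
  "bipartite G \<longleftrightarrow> (\<exists>U W. verts G = U \<union> W \<and> U \<inter> W = {} \<and>
     (\<forall>e \<in> undirected_edges G. \<exists>u \<in> U. \<exists>w \<in> W. e = {u, w}))"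

text \<open>\<^const>\<open>connected\<close> requires at least one vertex; the one-vertex graph is an Euler graph.\<close>

definition euler_graph :: "('a, 'b) pre_digraph \<Rightarrow> bool" where
  "euler_graph G \<longleftrightarrow> graph G \<and> connected G \<and> (\<forall>v \<in> verts G. even (degree G v))"

definition epsilon0 :: "('a, 'b) pre_digraph set" where
  "epsilon0 = {G. euler_graph G \<and> (\<forall>c. undirected_cycle G c \<longrightarrow> [length c = 0] (mod 4))}"

end

theory Submission
  imports Defs
begin

text \<open>
  A closed walk that repeats a vertex splits into two shorter closed walks, so all closed walks of
  a graph in \<open>\<epsilon>\<^sub>0\<close> are even and the parity of the distance to a root is a proper 2-colouring.
  For the number of edges, remove cycles one after the other: all degrees stay even and each removal
  takes away a multiple of 4 edges. As long as an edge remains there is a cycle, because an end of a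
  longest path has a second neighbour, which lies on the path.
\<close>

section \<open>Edges of arcs and deletion of edges\<close>

definition edge_of :: "('a, 'b) pre_digraph \<Rightarrow> 'b \<Rightarrow> 'a set" where
  "edge_of G a = {tail G a, head G a}"

lemma undirected_edges_eq_image: "undirected_edges G = edge_of G ` arcs G"
  unfolding undirected_edges_def edge_of_def by blast

text \<open>Deletion goes by edges, so an arc and its reverse disappear together and the digraph
  stays symmetric. All vertices stay.\<close>

definition del_edges :: "('a, 'b) pre_digraph \<Rightarrow> 'a set set \<Rightarrow> ('a, 'b) pre_digraph" where
  "del_edges G F = G\<lparr>arcs := {a \<in> arcs G. edge_of G a \<notin> F}\<rparr>"

lemma del_edges_simps [simp]:
  "verts (del_edges G F) = verts G"
  "arcs (del_edges G F) = {a \<in> arcs G. edge_of G a \<notin> F}"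
  "tail (del_edges G F) = tail G"
  "head (del_edges G F) = head G"
  by (simp_all add: del_edges_def)

lemma undirected_edges_del_edges:
  "undirected_edges (del_edges G F) = undirected_edges G - F"
  unfolding undirected_edges_eq_image by (auto simp: edge_of_def)

lemma graph_del_edges:
  assumes "graph G"
  shows "graph (del_edges G F)"
proof -
  interpret graph G by fact
  have "\<exists>b \<in> arcs (del_edges G F). tail G a = head G b \<and> head G a = tail G b"
    if "a \<in> arcs (del_edges G F)" for a
  proof -
    obtain b where "b \<in> arcs G" "tail G a = head G b" "head G a = tail G b"
      using sym_arcs \<open>a \<in> _\<close> by (auto simp: symmetric_conv)
    then show ?thesis
      using \<open>a \<in> _\<close> by (auto simp: edge_of_def insert_commute)
  qed
  then have "symmetric (del_edges G F)"
    by (simp add: symmetric_conv)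
  then show ?thesis
    by unfold_locales (auto simp: no_loops arc_to_ends_def intro: no_multi_arcs)
qed

lemma undirected_cycle_del_edges:
  assumes "graph G" and "undirected_cycle (del_edges G F) c"
  shows "undirected_cycle G c"
proof -
  interpret graph G by fact
  interpret H: graph "del_edges G F" using \<open>graph G\<close> by (rule graph_del_edges)
  have "subgraph (del_edges G F) G"
    unfolding subgraph_def compatible_def using wf_digraph H.wf_digraph by auto
  then show ?thesis
    using assms(2) by (auto simp: undirected_cycle_def intro: subgraph_cycle)
qed

section \<open>Closed walks and paths without repeated edges\<close>

text \<open>Each visit to \<open>v\<close> is entered and left once, except that the start is not
  entered and the end is not left; the two \<open>of_bool\<close> terms compensate for this and
  cancel on a closed walk.\<close>

lemma (in wf_digraph) count_tails_heads_awalk: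
  assumes "awalk u p w"
  shows "length (filter (\<lambda>a. tail G a = v) p) + of_bool (w = v) =
    length (filter (\<lambda>a. head G a = v) p) + of_bool (u = v)"
  using assms
proof (induction p arbitrary: u)
  case (Cons a p)
  then have "u = tail G a" "awalk (head G a) p w"
    by (auto simp: awalk_Cons_iff)
  then show ?case
    using Cons.IH[of "head G a"] by auto
qed (simp add: awalk_Nil_iff)

text \<open>As the edges are distinct, each edge at \<open>v\<close> comes from exactly one arc of
  \<open>p\<close>. Without loops that arc either leaves or enters \<open>v\<close>, not both, and
  the walk leaves \<open>v\<close> as often as it enters it.\<close>

lemma (in loopfree_digraph) even_edges_at_vertex_closed_awalk:
  assumes "awalk u p u" and "distinct (map (edge_of G) p)"
  shows "even (card {e \<in> edge_of G ` set p. v \<in> e})"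
proof -
  let ?T = "{a \<in> set p. tail G a = v}" and ?H = "{a \<in> set p. head G a = v}"
  have arcs: "set p \<subseteq> arcs G" using assms(1) by auto
  have inj: "inj_on (edge_of G) (set p)" and "distinct p"
    using assms(2) by (auto simp: distinct_map)
  have card_filter: "card {a \<in> set p. P a} = length (filter P p)" for P
    using distinct_card[OF distinct_filter[OF \<open>distinct p\<close>], of P] by simp
  have "{e \<in> edge_of G ` set p. v \<in> e} = edge_of G ` (?T \<union> ?H)"
    by (auto simp: edge_of_def)
  also have "card \<dots> = card (?T \<union> ?H)"
    using inj by (intro card_image) (auto simp: inj_on_def)
  also have "\<dots> = card ?T + card ?H"
    using arcs no_loops by (intro card_Un_disjoint) (auto, metis subsetD)
  also have "card ?T = card ?H"
    using count_tails_heads_awalk[OF assms(1), of v] card_filter by simp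
  finally show ?thesis by simp
qed

text \<open>A later arc with the edge of the first one would bring the path back to its starting
  vertex.\<close>

lemma (in wf_digraph) distinct_edges_apath:
  assumes "apath u p v"
  shows "distinct (map (edge_of G) p)"
  using assms
proof (induction p arbitrary: u)
  case (Cons a p)
  have "edge_of G b \<noteq> edge_of G a" if "b \<in> set p" for b
  proof
    assume "edge_of G b = edge_of G a"
    then have "u \<in> {tail G b, head G b}"
      using Cons.prems by (auto simp: edge_of_def apath_Cons_iff)
    moreover have "awalk (head G a) p v" "u \<notin> set (awalk_verts (head G a) p)"
      using Cons.prems by (auto simp: apath_Cons_iff intro: awalkI_apath)
    ultimately show False
      using \<open>b \<in> set p\<close> by (auto simp: set_awalk_verts)
  qed
  with Cons show ?case
    by (auto simp: apath_Cons_iff)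
qed simp

section \<open>Existence of a cycle\<close>

text \<open>Otherwise the edge of \<open>a\<close> would be the only one at \<open>tail G a\<close>,
  whose degree would be 1.\<close>

lemma (in graph) out_arc_avoiding:
  assumes "a \<in> arcs G" and "even (degree G (tail G a))"
  obtains b where "b \<in> arcs G" "tail G b = tail G a" "head G b \<noteq> head G a"
proof (rule ccontr)
  assume "\<not> thesis"
  with that have unique: "head G b = head G a" if "b \<in> arcs G" "tail G b = tail G a" for b
    using \<open>b \<in> arcs G\<close> \<open>tail G b = tail G a\<close> by blast
  have "edge_of G b = edge_of G a" if b: "b \<in> arcs G" "tail G a \<in> edge_of G b" for b
  proof (cases "tail G b = tail G a")
    case True
    then show ?thesis using unique b by (simp add: edge_of_def)
  next
    case False
    obtain b' where "b' \<in> arcs G" "tail G b = head G b'" "head G b = tail G b'"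
      using sym_arcs b(1) by (auto simp: symmetric_conv)
    then show ?thesis using unique[of b'] b False by (auto simp: edge_of_def)
  qed
  moreover have "tail G a \<in> edge_of G a"
    by (simp add: edge_of_def)
  ultimately have "{e \<in> undirected_edges G. tail G a \<in> e} = {edge_of G a}"
    unfolding undirected_edges_eq_image using assms(1) by blast
  then show False
    using assms(2) by (simp add: degree_def)
qed

text \<open>Distinct edges are part of the conclusion so that removing the cycle takes away exactly
  \<open>length c\<close> edges.\<close>

lemma (in graph) exists_undirected_cycle:
  assumes "arcs G \<noteq> {}" and even: "\<forall>v \<in> verts G. even (degree G v)"
  obtains u c where "awalk u c u" "undirected_cycle G c" "distinct (map (edge_of G) c)"
proof -
  let ?P = "\<lambda>n. \<exists>u p v. apath u p v \<and> length p = n"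
  obtain a0 where "a0 \<in> arcs G" using assms(1) by blast
  then have "?P 1"
    using no_loops[of a0]
    by (intro exI[of _ "tail G a0"] exI[of _ "[a0]"] exI[of _ "head G a0"]) (simp add: apath_simps)
  moreover have bound: "\<forall>n. ?P n \<longrightarrow> n \<le> card (verts G)"
    using length_apath by blast
  ultimately obtain m where m: "?P m" and max: "\<And>n. ?P n \<Longrightarrow> n \<le> m" and "1 \<le> m"
    using GreatestI_nat[of ?P, OF _ bound[rule_format]] Greatest_le_nat[of ?P, OF _ bound[rule_format]]
    by blast
  from m obtain u p v where "apath u p v" "length p = m"
    by blast
  with \<open>1 \<le> m\<close> obtain e es where p: "apath u (e # es) v" "length (e # es) = m"
    by (cases p) auto
  have e: "e \<in> arcs G" "tail G e = u" using p by (auto simp: apath_Cons_iff)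
  obtain b where b: "b \<in> arcs G" "tail G b = u" "head G b \<noteq> head G e"
    using out_arc_avoiding[of e] e even by (metis tail_in_verts)
  \<comment> \<open>The reverse of \<open>b\<close> points into \<open>u\<close>, so it can be put
    in front of the longest path.\<close>
  obtain a where a: "a \<in> arcs G" "head G a = u" "tail G a \<noteq> head G e"
    using sym_arcs b by (metis symmetric_conv)
  define w where "w = tail G a"
  have "w \<in> set (awalk_verts u (e # es))"
  proof (rule ccontr)
    assume "w \<notin> set (awalk_verts u (e # es))"
    then have "apath w (a # e # es) v"
      using p a by (simp add: apath_Cons_iff[of _ a] w_def)
    then have "Suc (length (e # es)) \<le> m"
      by (intro max exI[of _ w] exI[of _ "a # e # es"] exI[of _ v]) simp
    then show False using p(2) by simp
  qed
  then obtain q r where qr: "e # es = q @ r" "awalk u q w" "awalk w r v"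
    using awalk_decomp[OF awalkI_apath[OF p(1)]] by blast
  then have q: "apath u q w"
    using p(1) by (auto simp: apath_append_iff)
  have "u \<noteq> w" using a(2) no_loops[OF a(1)] by (simp add: w_def)
  then have "q \<noteq> []" using qr(2) by (auto simp: awalk_Nil_iff)
  then obtain q' where q': "q = e # q'"
    using qr(1) by (cases q) auto
  \<comment> \<open>If \<open>q\<close> were just \<open>e\<close>, then \<open>w\<close> would be
    \<open>head G e\<close>, against the choice of \<open>a\<close>. Hence \<open>a # q\<close> has
    at least 3 arcs.\<close>
  have "q' \<noteq> []" using q q' a(3) by (auto simp: apath_simps w_def)
  have "awalk w (a # q) w"
    using a(1,2) qr(2) by (simp add: awalk_Cons_iff w_def)
  \<comment> \<open>Without its first entry, the vertex list of \<open>a # q\<close> is that of the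
    path \<open>q\<close>.\<close>
  moreover have "undirected_cycle G (a # q)"
    unfolding undirected_cycle_def cycle_def
    using \<open>awalk w (a # q) w\<close> q q' \<open>q' \<noteq> []\<close> a(2)
    by (auto simp: apath_def Suc_le_eq intro!: exI[of _ w])
  moreover have "distinct (map (edge_of G) (a # q))"
  proof -
    have "edge_of G b \<noteq> edge_of G a" if "b \<in> set q'" for b
    proof -
      have "awalk (head G e) q' w" "u \<notin> set (awalk_verts (head G e) q')"
        using q q' e by (auto simp: apath_Cons_iff intro: awalkI_apath)
      then have "u \<notin> edge_of G b"
        using \<open>b \<in> set q'\<close> by (auto simp: set_awalk_verts edge_of_def)
      then show ?thesis using a by (auto simp: edge_of_def)
    qed
    moreover have "edge_of G e \<noteq> edge_of G a"
      using a(2,3) e(2) by (auto simp: edge_of_def doubleton_eq_iff)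
    ultimately show ?thesis
      using distinct_edges_apath[OF q] q' by auto
  qed
  ultimately show ?thesis by (rule that)
qed

section \<open>Counting edges by removing cycles\<close>

text \<open>The induction ranges over possibly disconnected graphs, since removing a cycle can
  disconnect a graph, whereas even degrees and the condition on cycles survive.\<close>

lemma dvd_card_undirected_edges:
  assumes "graph G" and "\<forall>v \<in> verts G. even (degree G v)"
    and "\<And>c. undirected_cycle G c \<Longrightarrow> k dvd length c"
  shows "k dvd card (undirected_edges G)"
  using assms
proof (induction "card (undirected_edges G)" arbitrary: G rule: less_induct)
  case less
  interpret graph G by fact
  have fin: "finite (undirected_edges G)"
    by (simp add: undirected_edges_eq_image)
  show ?case
  proof (cases "arcs G = {}")
    case True
    then show ?thesis by (simp add: undirected_edges_eq_image)
  next
    case False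
    then obtain u c where c: "awalk u c u" "undirected_cycle G c" "distinct (map (edge_of G) c)"
      using exists_undirected_cycle less.prems(2) by blast
    let ?F = "edge_of G ` set c" and ?H = "del_edges G (edge_of G ` set c)"
    have F: "?F \<subseteq> undirected_edges G"
      using c(1) by (auto simp: undirected_edges_eq_image)
    have "card ?F = length c"
      using distinct_card[OF c(3)] by simp
    then have card: "card (undirected_edges G) = card (undirected_edges ?H) + length c"
      using F fin by (metis undirected_edges_del_edges card_Diff_subset card_mono finite_subset
          le_add_diff_inverse2)
    \<comment> \<open>This makes the number of edges drop strictly, as the induction
      requires.\<close>
    have "c \<noteq> []" using c(2) by (auto simp: undirected_cycle_def)
    have "even (degree ?H v)" if "v \<in> verts G" for v
    proof -
      have sub: "{e \<in> ?F. v \<in> e} \<subseteq> {e \<in> undirected_edges G. v \<in> e}" using F by auto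
      have "{e \<in> undirected_edges ?H. v \<in> e} = {e \<in> undirected_edges G. v \<in> e} - {e \<in> ?F. v \<in> e}"
        by (auto simp: undirected_edges_del_edges)
      then have "degree ?H v = degree G v - card {e \<in> ?F. v \<in> e}"
        unfolding degree_def using sub by (simp add: card_Diff_subset)
      then show ?thesis
        using less.prems(2) that even_edges_at_vertex_closed_awalk[OF c(1,3), of v] by simp
    qed
    then have "k dvd card (undirected_edges ?H)"
      using less.prems card \<open>c \<noteq> []\<close>
      by (intro less.hyps) (auto intro: graph_del_edges undirected_cycle_del_edges)
    then show ?thesis
      using card less.prems(3)[OF c(2)] by simp
  qed
qed

section \<open>Bipartiteness\<close>

lemma (in loopfree_digraph) even_closed_awalk:
  assumes "\<And>c. undirected_cycle G c \<Longrightarrow> even (length c)" and "awalk u p u"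
  shows "even (length p)"
  using assms(2)
proof (induction "length p" arbitrary: u p rule: less_induct)
  case less
  show ?case
  proof (cases p)
    case (Cons e es)
    have es: "awalk (head G e) es u" and e: "e \<in> arcs G" "tail G e = u"
      using less.prems Cons by (auto simp: awalk_Cons_iff)
    show ?thesis
    proof (cases "distinct (awalk_verts (head G e) es)")
      case True
      then have "cycle p"
        using less.prems Cons unfolding cycle_def by (intro exI[of _ u]) simp
      \<comment> \<open>Length 1 would be a loop. Length 2, an arc and its way back, is no
        \<open>undirected_cycle\<close> but is even anyway.\<close>
      then have "2 \<le> length p" by (auto simp: cycle_digraph_conv)
      then show ?thesis
        using assms(1)[of p] \<open>cycle p\<close>
        by (cases "length p = 2") (auto simp: undirected_cycle_def)
    next
      case False
      then obtain q r s w where qrs: "es = q @ r @ s" "0 < length r"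
        "awalk (head G e) q w" "awalk w r w" "awalk w s u"
        using awalk_not_distinct_decomp[OF es] by blast
      \<comment> \<open>Cutting out the closed walk \<open>r\<close> leaves a closed walk that is
        shorter because \<open>r\<close> is nonempty; \<open>r\<close> itself is shorter because it
        misses \<open>e\<close>.\<close>
      have "awalk u (e # q @ s) u"
        using awalk_appendI[OF qrs(3,5)] e by (simp add: awalk_Cons_iff)
      then have "even (length (e # q @ s))"
        using qrs Cons by (intro less.hyps) auto
      moreover have "even (length r)"
        using qrs Cons by (intro less.hyps) auto
      ultimately show ?thesis using qrs Cons by simp
    qed
  qed simp
qed

lemma (in graph) bipartite_if_even_cycles:
  assumes conn: "connected G" and even: "\<And>c. undirected_cycle G c \<Longrightarrow> even (length c)"
  shows "bipartite G"
proof -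
  have strong: "strongly_connected G"
    using conn sym_arcs by (intro symmetric_connected_imp_strongly_connected)
  then obtain r where r: "r \<in> verts G" by (auto simp: strongly_connected_def)
  \<comment> \<open>Parity of arbitrary walks from \<open>r\<close> replaces parity of the distance:
    no shortest walks are involved, and disjointness of the classes becomes the point to
    prove.\<close>
  define U where "U = {v. \<exists>p. awalk r p v \<and> even (length p)}"
  define W where "W = {v. \<exists>p. awalk r p v \<and> odd (length p)}"
  have UW: "verts G = U \<union> W"
  proof
    show "verts G \<subseteq> U \<union> W"
    proof
      fix v assume "v \<in> verts G"
      then obtain p where "awalk r p v"
        using strong r by (auto simp: strongly_connected_def reachable_awalk)
      then show "v \<in> U \<union> W" by (auto simp: U_def W_def)
    qed
  qed (auto simp: U_def W_def)
  have "False" if v: "v \<in> U" "v \<in> W" for v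
  proof -
    obtain p p' where p: "awalk r p v" "even (length p)" "awalk r p' v" "odd (length p')"
      using v by (auto simp: U_def W_def)
    have "v \<in> verts G" using UW v by auto
    \<comment> \<open>The same way back \<open>s\<close> closes both walks, so their lengths have
      equal parity.\<close>
    then obtain s where "awalk v s r"
      using strong r by (auto simp: strongly_connected_def reachable_awalk)
    then have "even (length (p @ s))" "even (length (p' @ s))"
      using even_closed_awalk[OF even] awalk_appendI p(1,3) by blast+
    with p show False by simp
  qed
  moreover have "\<exists>u \<in> U. \<exists>w \<in> W. e = {u, w}" if "e \<in> undirected_edges G" for e
  proof -
    obtain a where a: "a \<in> arcs G" "e = {tail G a, head G a}"
      using \<open>e \<in> _\<close> by (auto simp: undirected_edges_def)
    \<comment> \<open>Appending \<open>a\<close> to a walk flips the parity, so the ends of an edge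
      lie in opposite classes.\<close>
    have step: "awalk r (p @ [a]) (head G a)" if "awalk r p (tail G a)" for p
      using awalk_appendI[OF that arc_implies_awalk[OF a(1)]] .
    have "tail G a \<in> U \<union> W" using UW tail_in_verts[OF a(1)] by simp
    moreover have "head G a \<in> W" if "tail G a \<in> U"
    proof -
      obtain p where "awalk r p (tail G a)" "even (length p)"
        using \<open>tail G a \<in> U\<close> unfolding U_def by blast
      then show ?thesis
        unfolding W_def by (intro CollectI exI[of _ "p @ [a]"] conjI step) simp_all
    qed
    moreover have "head G a \<in> U" if "tail G a \<in> W"
    proof -
      obtain p where "awalk r p (tail G a)" "odd (length p)"
        using \<open>tail G a \<in> W\<close> unfolding W_def by blast
      then show ?thesis
        unfolding U_def by (intro CollectI exI[of _ "p @ [a]"] conjI step) simp_all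
    qed
    ultimately consider "tail G a \<in> U" "head G a \<in> W" | "tail G a \<in> W" "head G a \<in> U"
      by blast
    then show ?thesis
      using a(2) by cases (auto simp: insert_commute)
  qed
  ultimately show ?thesis
    unfolding bipartite_def using UW by (intro exI[of _ U] exI[of _ W]) auto
qed

theorem theorem2:
  fixes G :: "('a, 'b) pre_digraph" and p q :: nat
  assumes "G \<in> epsilon0"
    and "card (verts G) = p"
    and "card (undirected_edges G) = q"
  shows "bipartite G \<and> [q = 0] (mod 4)"
proof
  have euler: "graph G" "connected G" "\<forall>v \<in> verts G. even (degree G v)"
    using assms(1) by (auto simp: epsilon0_def euler_graph_def)
  have cycles: "4 dvd length c" if "undirected_cycle G c" for c
    using assms(1) that by (auto simp: epsilon0_def cong_0_iff)
  interpret graph G by fact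
  have "even (length c)" if "undirected_cycle G c" for c
    using cycles[OF that] dvd_trans[of 2 4 "length c"] by simp
  then show "bipartite G"
    using euler(2) by (intro bipartite_if_even_cycles)
  show "[q = 0] (mod 4)"
    using dvd_card_undirected_edges[OF euler(1,3) cycles] assms(3) by (simp add: cong_0_iff)
qed

end
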